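(* Let $W$ be a group generated by involutions indexed by a set $\mathcal I$ ($\mathcal I\hookrightarrow W$). Let $\Delta$ be a nonempty, firm, connected chamber system over $\mathcal I$ with an apartment complex $\mathscr A$ whose apartments have structure group $W$ (as a group generated by $\mathcal I$), and let $G$ be a group of chamber automorphisms of $\Delta$ preserving $\mathscr A$ which is strongly transitive and satisfies: (R) for any chamber $b\in\Delta$ and any $p$ which is either a chamber or an $i$-panel (for some $i\in\mathcal I$), $\mathrm{Stab}_G(b)\cap\mathrm{Stab}_G(p)$ acts transitively on $\{A\in\mathscr A : b\in A,\ p\in A\}$. Then $\Delta$ is a building: there is a $W$-distance $\delta_\Delta:\Delta\times\Delta\to W$ with which the apartments in $\mathscr A$ are compatible (and any two chambers lie in such an apartment). Moreover $\delta_\Delta$ induces a bijection $G\backslash(\Delta\times\Delta)\to W$.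
   Context: A \emph{chamber system} over $\mathcal I$ is a graph $\Delta$ (undirected, no loops or multiple edges; vertices are called chambers) with an edge labelling by $\mathcal I$ such that for each $i\in\mathcal I$ the relation of $i$-adjacency, $b\sim_i c$ iff $b=c$ or $\{b,c\}$ is an edge labelled $i$, is an equivalence relation. The equivalence classes are the $i$-\emph{panels}. A chamber morphism is a map on chambers preserving $\sim_i$ for every $i\in\mathcal I$. A chamber subsystem is a subset of chambers with the induced edges and labels. A chamber system is \emph{firm} (resp. \emph{thin}) if every $i$-panel, for all $i$, contains at least two (resp. exactly two) chambers. For an $i$-panel $p$ and a chamber subsystem $A$, $p\in A$ means $p\cap A\neq\varnothing$. In a thin chamber system $A$, for each $i\in\mathcal I$ let $b\mapsto bi$ be the free involution interchanging the two chambers in each $i$-panel; the structure group $W_A$ is the group of permutations of the chambers generated by these involutions, acting on the right. $A$ is \emph{homogeneous} if its automorphism group acts transitively on chambers; for a connected homogeneous thin chamber system, $W_A$ acts simply transitively on chambers, and $\delta_A:A\times A\to W_A$ is defined by $\delta_A(b,c)=w$ iff $c=bw$. A group $W$ generated by involutions indexed by $\mathcal I$ is itself viewed as a chamber system: $w\sim_i w'$ iff $w'=w$ or $w'=wi$. An \emph{apartment} in $\Delta$ is a connected homogeneous thin chamber subsystem. An \emph{apartment complex} $\mathscr A$ in $\Delta$ is a set of apartments such that any two chambers of $\Delta$ belong to a common apartment in $\mathscr A$. A \emph{$W$-distance} on $\Delta$ is a map $\delta_\Delta:\Delta\times\Delta\to W$ such that $\delta_\Delta(b,c)=\delta_\Delta(c,b)^{-1}$,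 and $c'\sim_i c$ implies $\delta_\Delta(b,c')\sim_i\delta_\Delta(b,c)$, for all chambers $b,c,c'$ and $i\in\mathcal I$. An apartment $A$ is \emph{compatible} with $\delta_\Delta$ if $W_A\cong W$ (respecting the generators labelled by $\mathcal I$) with $\delta_A=\delta_\Delta|_A$. $(\Delta,\delta_\Delta)$ is a \emph{building} (of type $W$) if any two chambers lie in a common compatible apartment. A group $G$ of chamber automorphisms of $\Delta$ preserving $\mathscr A$ is \emph{strongly transitive} if it acts transitively on $\{(a,A): a\in A\in\mathscr A\}$. *)

theory Defs
  imports "HOL-Algebra.Group_Action" "HOL-Algebra.Generated_Groups"
begin

section \<open>Chamber systems\<close>

text \<open>The label of a set that is not an edge is irrelevant.\<close>

record ('c, 'i) chamber_graph =
  chambers :: "'c set"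
  edges :: "'c set set"
  label :: "'c set \<Rightarrow> 'i"

definition adj :: "('c, 'i) chamber_graph \<Rightarrow> 'i \<Rightarrow> ('c \<times> 'c) set" where
  "adj \<Delta> i = {(b, c). b \<in> chambers \<Delta> \<and> c \<in> chambers \<Delta> \<and>
                (b = c \<or> ({b, c} \<in> edges \<Delta> \<and> label \<Delta> {b, c} = i))}"

definition chamber_system :: "'i set \<Rightarrow> ('c, 'i) chamber_graph \<Rightarrow> bool" where
  "chamber_system I \<Delta> \<longleftrightarrow>
     edges \<Delta> \<subseteq> {{b, c} | b c. b \<in> chambers \<Delta> \<and> c \<in> chambers \<Delta> \<and> b \<noteq> c} \<and>
     label \<Delta> ` edges \<Delta> \<subseteq> I \<and>
     (\<forall>i\<in>I. equiv (chambers \<Delta>) (adj \<Delta> i))"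

definition panels :: "('c, 'i) chamber_graph \<Rightarrow> 'i \<Rightarrow> 'c set set" where
  "panels \<Delta> i = chambers \<Delta> // adj \<Delta> i"

definition chamber_morphism ::
    "'i set \<Rightarrow> ('c, 'i) chamber_graph \<Rightarrow> ('d, 'i) chamber_graph \<Rightarrow> ('c \<Rightarrow> 'd) \<Rightarrow> bool" where
  "chamber_morphism I \<Delta> \<Delta>' f \<longleftrightarrow>
     f \<in> chambers \<Delta> \<rightarrow> chambers \<Delta>' \<and>
     (\<forall>i\<in>I. \<forall>(b, c) \<in> adj \<Delta> i. (f b, f c) \<in> adj \<Delta>' i)"

text \<open>The group of automorphisms, as a group of permutations of the chambers composed as functions
  (so that it acts from the left).\<close>

definition chamber_Aut :: "'i set \<Rightarrow> ('c, 'i) chamber_graph \<Rightarrow> ('c \<Rightarrow> 'c) monoid" where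
  "chamber_Aut I \<Delta> = BijGroup (chambers \<Delta>)
     \<lparr>carrier := {f \<in> Bij (chambers \<Delta>). chamber_morphism I \<Delta> \<Delta> f \<and>
                   chamber_morphism I \<Delta> \<Delta> (inv_into (chambers \<Delta>) f)}\<rparr>"

text \<open>The chamber subsystem on a subset of the chambers.\<close>

definition subsystem :: "('c, 'i) chamber_graph \<Rightarrow> 'c set \<Rightarrow> ('c, 'i) chamber_graph" where
  "subsystem \<Delta> A = \<Delta>\<lparr>chambers := A, edges := {e \<in> edges \<Delta>. e \<subseteq> A}\<rparr>"

definition firm :: "'i set \<Rightarrow> ('c, 'i) chamber_graph \<Rightarrow> bool" where
  "firm I \<Delta> \<longleftrightarrow> (\<forall>i\<in>I. \<forall>p\<in>panels \<Delta> i. \<exists>b\<in>p. \<exists>c\<in>p. b \<noteq> c)"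

definition thin :: "'i set \<Rightarrow> ('c, 'i) chamber_graph \<Rightarrow> bool" where
  "thin I \<Delta> \<longleftrightarrow> (\<forall>i\<in>I. \<forall>p\<in>panels \<Delta> i. card p = 2)"

definition chamber_connected :: "('c, 'i) chamber_graph \<Rightarrow> bool" where
  "chamber_connected \<Delta> \<longleftrightarrow>
     (\<forall>b\<in>chambers \<Delta>. \<forall>c\<in>chambers \<Delta>. (b, c) \<in> {(x, y). {x, y} \<in> edges \<Delta>}\<^sup>*)"

text \<open>Transitivity of a set of transformations, acting through \<open>\<phi>\<close>, on a set; as in
  \<^locale>\<open>transitive_action\<close>, but without requiring the acting functions to be extensional.\<close>

definition transitive_on :: "'g set \<Rightarrow> ('g \<Rightarrow> 'x \<Rightarrow> 'x) \<Rightarrow> 'x set \<Rightarrow> bool" where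
  "transitive_on H \<phi> X \<longleftrightarrow> (\<forall>x\<in>X. \<forall>y\<in>X. \<exists>h\<in>H. \<phi> h x = y)"

definition homogeneous :: "'i set \<Rightarrow> ('c, 'i) chamber_graph \<Rightarrow> bool" where
  "homogeneous I \<Delta> \<longleftrightarrow> transitive_on (carrier (chamber_Aut I \<Delta>)) (\<lambda>f. f) (chambers \<Delta>)"


section \<open>The structure group of a thin chamber system\<close>

definition flip :: "('c, 'i) chamber_graph \<Rightarrow> 'i \<Rightarrow> 'c \<Rightarrow> 'c" where
  "flip \<Delta> i = (\<lambda>b\<in>chambers \<Delta>. THE c. (b, c) \<in> adj \<Delta> i \<and> c \<noteq> b)"

text \<open>Permutations acting from the right: the product \<open>f g\<close> is ``first \<open>f\<close>, then \<open>g\<close>'',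
  the opposite of the product in \<^const>\<open>BijGroup\<close>.\<close>

definition right_BijGroup :: "'c set \<Rightarrow> ('c \<Rightarrow> 'c) monoid" where
  "right_BijGroup S = (BijGroup S)\<lparr>mult := \<lambda>f g. g \<otimes>\<^bsub>BijGroup S\<^esub> f\<rparr>"

definition structure_group :: "'i set \<Rightarrow> ('c, 'i) chamber_graph \<Rightarrow> ('c \<Rightarrow> 'c) monoid" where
  "structure_group I \<Delta> = (right_BijGroup (chambers \<Delta>))
     \<lparr>carrier := generate (right_BijGroup (chambers \<Delta>)) (flip \<Delta> ` I)\<rparr>"

text \<open>Only meaningful when the structure group acts simply transitively.\<close>

definition thin_dist :: "'i set \<Rightarrow> ('c, 'i) chamber_graph \<Rightarrow> 'c \<Rightarrow> 'c \<Rightarrow> ('c \<Rightarrow> 'c)" where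
  "thin_dist I \<Delta> b c = (THE w. w \<in> carrier (structure_group I \<Delta>) \<and> c = w b)"


section \<open>Groups generated by involutions\<close>

text \<open>\<open>s\<close> is the inclusion of the index set \<open>I\<close> into \<open>W\<close>.\<close>

definition involution_group :: "('w, 'm) monoid_scheme \<Rightarrow> 'i set \<Rightarrow> ('i \<Rightarrow> 'w) \<Rightarrow> bool" where
  "involution_group W I s \<longleftrightarrow>
     group W \<and> s \<in> I \<rightarrow> carrier W \<and> inj_on s I \<and>
     (\<forall>i\<in>I. s i \<noteq> \<one>\<^bsub>W\<^esub> \<and> s i \<otimes>\<^bsub>W\<^esub> s i = \<one>\<^bsub>W\<^esub>) \<and>
     generate W (s ` I) = carrier W"

definition group_adj :: "('w, 'm) monoid_scheme \<Rightarrow> ('i \<Rightarrow> 'w) \<Rightarrow> 'i \<Rightarrow> ('w \<times> 'w) set" where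
  "group_adj W s i = {(w, w'). w \<in> carrier W \<and> w' \<in> carrier W \<and> (w' = w \<or> w' = w \<otimes>\<^bsub>W\<^esub> s i)}"

definition structure_isos ::
    "('w, 'm) monoid_scheme \<Rightarrow> 'i set \<Rightarrow> ('i \<Rightarrow> 'w) \<Rightarrow> ('c, 'i) chamber_graph \<Rightarrow> (('c \<Rightarrow> 'c) \<Rightarrow> 'w) set" where
  "structure_isos W I s \<Delta> = {\<phi> \<in> iso (structure_group I \<Delta>) W. \<forall>i\<in>I. \<phi> (flip \<Delta> i) = s i}"


section \<open>Apartments and buildings\<close>

definition apartment :: "'i set \<Rightarrow> ('c, 'i) chamber_graph \<Rightarrow> 'c set \<Rightarrow> bool" where
  "apartment I \<Delta> A \<longleftrightarrow>
     A \<subseteq> chambers \<Delta> \<and> chamber_connected (subsystem \<Delta> A) \<and>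
     homogeneous I (subsystem \<Delta> A) \<and> thin I (subsystem \<Delta> A)"

definition apartment_complex :: "'i set \<Rightarrow> ('c, 'i) chamber_graph \<Rightarrow> 'c set set \<Rightarrow> bool" where
  "apartment_complex I \<Delta> \<A> \<longleftrightarrow>
     (\<forall>A\<in>\<A>. apartment I \<Delta> A) \<and>
     (\<forall>b\<in>chambers \<Delta>. \<forall>c\<in>chambers \<Delta>. \<exists>A\<in>\<A>. b \<in> A \<and> c \<in> A)"

definition W_distance ::
    "('w, 'm) monoid_scheme \<Rightarrow> 'i set \<Rightarrow> ('i \<Rightarrow> 'w) \<Rightarrow> ('c, 'i) chamber_graph \<Rightarrow> ('c \<Rightarrow> 'c \<Rightarrow> 'w) \<Rightarrow> bool" where
  "W_distance W I s \<Delta> \<delta> \<longleftrightarrow>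
     (\<forall>b\<in>chambers \<Delta>. \<forall>c\<in>chambers \<Delta>. \<delta> b c \<in> carrier W \<and> \<delta> b c = inv\<^bsub>W\<^esub> (\<delta> c b)) \<and>
     (\<forall>i\<in>I. \<forall>b\<in>chambers \<Delta>. \<forall>(c', c) \<in> adj \<Delta> i. (\<delta> b c', \<delta> b c) \<in> group_adj W s i)"

definition compatible ::
    "('w, 'm) monoid_scheme \<Rightarrow> 'i set \<Rightarrow> ('i \<Rightarrow> 'w) \<Rightarrow> ('c, 'i) chamber_graph \<Rightarrow> ('c \<Rightarrow> 'c \<Rightarrow> 'w) \<Rightarrow>
      'c set \<Rightarrow> bool" where
  "compatible W I s \<Delta> \<delta> A \<longleftrightarrow>
     (\<exists>\<phi>\<in>structure_isos W I s (subsystem \<Delta> A).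
        \<forall>b\<in>A. \<forall>c\<in>A. \<phi> (thin_dist I (subsystem \<Delta> A) b c) = \<delta> b c)"

definition building ::
    "('w, 'm) monoid_scheme \<Rightarrow> 'i set \<Rightarrow> ('i \<Rightarrow> 'w) \<Rightarrow> ('c, 'i) chamber_graph \<Rightarrow> ('c \<Rightarrow> 'c \<Rightarrow> 'w) \<Rightarrow> bool" where
  "building W I s \<Delta> \<delta> \<longleftrightarrow>
     chamber_system I \<Delta> \<and> W_distance W I s \<Delta> \<delta> \<and>
     (\<forall>b\<in>chambers \<Delta>. \<forall>c\<in>chambers \<Delta>.
        \<exists>A. apartment I \<Delta> A \<and> compatible W I s \<Delta> \<delta> A \<and> b \<in> A \<and> c \<in> A)"


section \<open>Groups of automorphisms\<close>

definition Aut_subgroup :: "'i set \<Rightarrow> ('c, 'i) chamber_graph \<Rightarrow> ('c \<Rightarrow> 'c) set \<Rightarrow> ('c \<Rightarrow> 'c) monoid" where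
  "Aut_subgroup I \<Delta> G = (chamber_Aut I \<Delta>)\<lparr>carrier := G\<rparr>"

definition preserves_complex :: "('c \<Rightarrow> 'c) set \<Rightarrow> 'c set set \<Rightarrow> bool" where
  "preserves_complex G \<A> \<longleftrightarrow> (\<forall>g\<in>G. \<forall>A\<in>\<A>. g ` A \<in> \<A>)"

definition strongly_transitive :: "('c \<Rightarrow> 'c) set \<Rightarrow> 'c set set \<Rightarrow> bool" where
  "strongly_transitive G \<A> \<longleftrightarrow>
     transitive_on G (\<lambda>g (a, A). (g a, g ` A)) {(a, A). a \<in> A \<and> A \<in> \<A>}"

text \<open>The two conjuncts are the cases of a chamber and of a panel; the stabilizer of a panel is
  its stabilizer as a set.\<close>

definition condition_R ::
    "'i set \<Rightarrow> ('c, 'i) chamber_graph \<Rightarrow> ('c \<Rightarrow> 'c) set \<Rightarrow> 'c set set \<Rightarrow> bool" where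
  "condition_R I \<Delta> G \<A> \<longleftrightarrow>
     (\<forall>b\<in>chambers \<Delta>.
       (\<forall>p\<in>chambers \<Delta>. transitive_on
          (stabilizer (Aut_subgroup I \<Delta> G) (\<lambda>g. g) b \<inter> stabilizer (Aut_subgroup I \<Delta> G) (\<lambda>g. g) p)
          (\<lambda>g A. g ` A) {A \<in> \<A>. b \<in> A \<and> p \<in> A}) \<and>
       (\<forall>i\<in>I. \<forall>p\<in>panels \<Delta> i. transitive_on
          (stabilizer (Aut_subgroup I \<Delta> G) (\<lambda>g. g) b \<inter> stabilizer (Aut_subgroup I \<Delta> G) (\<lambda>g X. g ` X) p)
          (\<lambda>g A. g ` A) {A \<in> \<A>. b \<in> A \<and> p \<inter> A \<noteq> {}}))"

text \<open>The diagonal action on pairs of chambers.\<close>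

definition pair_action :: "('c \<Rightarrow> 'c) \<Rightarrow> 'c \<times> 'c \<Rightarrow> 'c \<times> 'c" where
  "pair_action g = (\<lambda>(b, c). (g b, g c))"

definition induces_orbit_bijection ::
    "('w, 'm) monoid_scheme \<Rightarrow> 'i set \<Rightarrow> ('c, 'i) chamber_graph \<Rightarrow> ('c \<Rightarrow> 'c) set \<Rightarrow>
      ('c \<Rightarrow> 'c \<Rightarrow> 'w) \<Rightarrow> bool" where
  "induces_orbit_bijection W I \<Delta> G \<delta> \<longleftrightarrow>
     (\<exists>f. bij_betw f (orbits (Aut_subgroup I \<Delta> G) (chambers \<Delta> \<times> chambers \<Delta>) pair_action) (carrier W) \<and>
       (\<forall>b\<in>chambers \<Delta>. \<forall>c\<in>chambers \<Delta>.
          f (orbit (Aut_subgroup I \<Delta> G) pair_action (b, c)) = \<delta> b c))"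

end

theory Submission
  imports Defs
begin

text \<open>In an apartment \<open>A\<close> the group \<open>W\<close> acts simply transitively from the right: it is transitive
  because \<open>A\<close> is connected and free because the automorphisms of \<open>A\<close>, which commute with \<open>W\<close>, are
  transitive. Hence every apartment carries a \<open>W\<close>-valued distance, and injective morphisms between
  apartments preserve it. By (R) for two chambers, the distance of \<open>b\<close> and \<open>c\<close> does not depend
  on the apartment containing them; by (R) for a chamber and a panel, apartments through \<open>b, c\<close> and
  \<open>b, c'\<close> with \<open>c\<close> and \<open>c'\<close> \<open>i\<close>-adjacent are related by an element fixing \<open>b\<close> and preserving the
  panel, so that the distance is a \<open>W\<close>-distance. Strong transitivity makes the fibres of the distance
  exactly the orbits of \<open>G\<close>.\<close>

section \<open>Thin chamber systems\<close>

lemma group_right_BijGroup: "group (right_BijGroup S)"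
proof -
  interpret B: group "BijGroup S" by (rule group_BijGroup)
  show ?thesis
  proof (rule groupI)
    fix x assume "x \<in> carrier (right_BijGroup S)"
    then show "\<exists>y\<in>carrier (right_BijGroup S).
        y \<otimes>\<^bsub>right_BijGroup S\<^esub> x = \<one>\<^bsub>right_BijGroup S\<^esub>"
      using B.r_inv B.inv_closed by (auto simp: right_BijGroup_def)
  qed (auto simp: right_BijGroup_def B.m_assoc)
qed

section \<open>Flips of panels and the structure group they generate\<close>

locale thin_system =
  fixes I :: "'i set" and X :: "('c, 'i) chamber_graph"
  assumes sys: "chamber_system I X" and thin: "thin I X"
begin

lemma equiv_adj: "i \<in> I \<Longrightarrow> equiv (chambers X) (adj X i)"
  using sys by (simp add: chamber_system_def)

text \<open>The panel of \<open>b\<close> is its equivalence class, and removing \<open>b\<close>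
  from a class of two chambers leaves exactly one. Hence the definite description in
  \<open>flip\<close> is meaningful.\<close>

lemma ex1_flip:
  assumes "i \<in> I" "b \<in> chambers X"
  shows "\<exists>!c. (b, c) \<in> adj X i \<and> c \<noteq> b"
proof -
  have "adj X i `` {b} \<in> panels X i"
    using assms by (simp add: panels_def quotientI)
  then have card: "card (adj X i `` {b}) = 2"
    using thin assms by (auto simp: thin_def)
  moreover have b: "b \<in> adj X i `` {b}"
    using equiv_class_self[OF equiv_adj] assms by simp
  ultimately have "card (adj X i `` {b} - {b}) = 1"
    by simp
  then obtain c where c: "adj X i `` {b} - {b} = {c}"
    by (rule card_1_singletonE)
  have "(b, d) \<in> adj X i \<and> d \<noteq> b \<longleftrightarrow> d = c" for d
    using arg_cong[OF c, of "\<lambda>S. d \<in> S"] by simp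
  then show ?thesis by auto
qed

lemma flip_adj:
  assumes "i \<in> I" "b \<in> chambers X"
  shows "(b, flip X i b) \<in> adj X i" "flip X i b \<noteq> b"
  using theI'[OF ex1_flip[OF assms]] assms by (simp_all add: flip_def)

text \<open>This is the form in which thinness is used later: a map that preserves adjacency and
  keeps adjacent chambers distinct must commute with flips.\<close>

lemma flip_eqI:
  assumes "i \<in> I" "(b, c) \<in> adj X i" "c \<noteq> b"
  shows "flip X i b = c"
  using assms ex1_flip[of i b] flip_adj[of i b] by (auto simp: adj_def)

lemma flip_closed: "i \<in> I \<Longrightarrow> b \<in> chambers X \<Longrightarrow> flip X i b \<in> chambers X"
  using flip_adj(1)[of i b] by (auto simp: adj_def)

lemma flip_flip:
  assumes "i \<in> I" "b \<in> chambers X"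
  shows "flip X i (flip X i b) = b"
  using flip_adj[OF assms] equiv_adj[OF assms(1)] assms(1)
  by (intro flip_eqI) (auto simp: equiv_def dest: symD)

text \<open>A flip is its own inverse, and its definition by restriction makes it extensional, as
  \<open>Bij\<close> demands.\<close>

lemma flip_Bij: "i \<in> I \<Longrightarrow> flip X i \<in> Bij (chambers X)"
  unfolding Bij_def
  by (auto simp: flip_closed flip_flip intro!: bij_betw_byWitness[where f' = "flip X i"])
    (simp add: flip_def)

lemma flip_image_subset: "flip X ` I \<subseteq> carrier (right_BijGroup (chambers X))"
  using flip_Bij by (auto simp: right_BijGroup_def BijGroup_def)

lemma subgroup_structure:
  "subgroup (generate (right_BijGroup (chambers X)) (flip X ` I)) (right_BijGroup (chambers X))"
  using group.generate_is_subgroup[OF group_right_BijGroup flip_image_subset] .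

lemma group_structure_group: "group (structure_group I X)"
  unfolding structure_group_def
  using subgroup.subgroup_is_group[OF subgroup_structure group_right_BijGroup] .

lemma structure_group_Bij: "carrier (structure_group I X) \<subseteq> Bij (chambers X)"
  using subgroup.subset[OF subgroup_structure]
  by (simp add: structure_group_def right_BijGroup_def BijGroup_def)

lemma flip_structure_group: "i \<in> I \<Longrightarrow> flip X i \<in> carrier (structure_group I X)"
  by (simp add: structure_group_def generate.incl)

lemma structure_group_closed:
  "u \<in> carrier (structure_group I X) \<Longrightarrow> b \<in> chambers X \<Longrightarrow> u b \<in> chambers X"
  using structure_group_Bij Bij_imp_funcset by fastforce

lemma structure_group_mult:
  assumes "u \<in> carrier (structure_group I X)" "v \<in> carrier (structure_group I X)" "b \<in> chambers X"
  shows "(u \<otimes>\<^bsub>structure_group I X\<^esub> v) b = v (u b)"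
  using assms structure_group_Bij
  by (auto simp: structure_group_def right_BijGroup_def BijGroup_def compose_def restrict_def)

lemma structure_group_one: "b \<in> chambers X \<Longrightarrow> \<one>\<^bsub>structure_group I X\<^esub> b = b"
  by (simp add: structure_group_def right_BijGroup_def BijGroup_def)

end

section \<open>The right action of \<open>W\<close> on a thin chamber system with structure group
  \<open>W\<close>\<close>

locale thin_system_of_type = thin_system I X
  for W :: "('w, 'm) monoid_scheme" and I :: "'i set" and s :: "'i \<Rightarrow> 'w"
    and X :: "('c, 'i) chamber_graph" and \<phi> :: "('c \<Rightarrow> 'c) \<Rightarrow> 'w" +
  assumes inv_group: "involution_group W I s"
    and isos: "\<phi> \<in> structure_isos W I s X"
begin

abbreviation "H \<equiv> structure_group I X"

text \<open>The action of the structure group transported to \<open>W\<close> along \<phi>: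
  \<open>act w b\<close> is the chamber written bw.\<close>

definition act :: "'w \<Rightarrow> 'c \<Rightarrow> 'c" where
  "act w = inv_into (carrier H) \<phi> w"

lemma group_W: "group W"
  using inv_group by (simp add: involution_group_def)

lemma iso: "\<phi> \<in> iso H W"
  using isos by (simp add: structure_isos_def)

lemma act_iso: "act \<in> iso W H"
  unfolding act_def by (rule group.iso_set_sym[OF group_structure_group iso])

lemma act_carrier: "w \<in> carrier W \<Longrightarrow> act w \<in> carrier H"
  using act_iso by (auto simp: iso_def hom_def)

lemma \<phi>_act: "w \<in> carrier W \<Longrightarrow> \<phi> (act w) = w"
  using iso unfolding act_def iso_def by (simp add: bij_betw_def f_inv_into_f)

lemma act_\<phi>: "u \<in> carrier H \<Longrightarrow> act (\<phi> u) = u"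
  using iso unfolding act_def iso_def by (simp add: bij_betw_def)

lemma \<phi>_carrier: "u \<in> carrier H \<Longrightarrow> \<phi> u \<in> carrier W"
  using iso by (auto simp: iso_def hom_def)

lemma act_closed: "w \<in> carrier W \<Longrightarrow> b \<in> chambers X \<Longrightarrow> act w b \<in> chambers X"
  using act_carrier structure_group_closed by blast

lemma act_mult:
  assumes "v \<in> carrier W" "w \<in> carrier W" "b \<in> chambers X"
  shows "act (v \<otimes>\<^bsub>W\<^esub> w) b = act w (act v b)"
proof -
  have "act (v \<otimes>\<^bsub>W\<^esub> w) = act v \<otimes>\<^bsub>H\<^esub> act w"
    using act_iso assms by (auto simp: iso_def hom_def)
  then show ?thesis
    using assms structure_group_mult act_carrier by simp
qed

lemma act_one: "b \<in> chambers X \<Longrightarrow> act \<one>\<^bsub>W\<^esub> b = b"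
  using hom_one[of act W H] act_iso group_W group_structure_group structure_group_one
  by (simp add: iso_def)

lemma act_gen: "i \<in> I \<Longrightarrow> act (s i) = flip X i"
  using act_\<phi>[OF flip_structure_group] isos by (auto simp: structure_isos_def)

lemma s_carrier: "i \<in> I \<Longrightarrow> s i \<in> carrier W"
  using inv_group by (auto simp: involution_group_def)

text \<open>Generation also adjoins inverses of generators, but each generator is an involution, so
  that case falls under \<open>gen\<close>.\<close>

lemma W_generated_induct [consumes 1, case_names one gen mult]:
  assumes "w \<in> carrier W" "P \<one>\<^bsub>W\<^esub>" "\<And>i. i \<in> I \<Longrightarrow> P (s i)"
    and "\<And>v w. v \<in> carrier W \<Longrightarrow> w \<in> carrier W \<Longrightarrow> P v \<Longrightarrow> P w \<Longrightarrow> P (v \<otimes>\<^bsub>W\<^esub> w)"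
  shows "P w"
proof -
  have gen: "generate W (s ` I) = carrier W"
    using inv_group by (simp add: involution_group_def)
  then have "w \<in> generate W (s ` I)" using assms(1) by simp
  then show ?thesis
  proof (induction rule: generate.induct)
    case (inv h)
    then obtain i where i: "i \<in> I" "h = s i" by auto
    then have "inv\<^bsub>W\<^esub> h = s i"
      using inv_group s_carrier group.inv_equality[OF group_W, of "s i" "s i"]
      by (simp add: involution_group_def)
    then show ?case using assms(3) i by simp
  qed (use assms gen in auto)
qed

end

text \<open>Injectivity keeps the two chambers of a panel apart, so thinness of \<open>Y\<close>
  forces \<open>f\<close> to commute with every flip, and induction over products of generators does
  the rest. With \<open>X = Y\<close> this says that automorphisms commute with
  \<open>W\<close>.\<close>

lemma act_morphism:
  assumes "thin_system_of_type W I s X \<phi>" "thin_system_of_type W I s Y \<psi>"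
    and f: "chamber_morphism I X Y f" and inj: "inj_on f (chambers X)"
    and "w \<in> carrier W" "b \<in> chambers X"
  shows "f (thin_system_of_type.act I X \<phi> w b) = thin_system_of_type.act I Y \<psi> w (f b)"
proof -
  interpret X: thin_system_of_type W I s X \<phi> by fact
  interpret Y: thin_system_of_type W I s Y \<psi> by fact
  have closed: "f c \<in> chambers Y" if "c \<in> chambers X" for c
    using f that by (auto simp: chamber_morphism_def)
  show ?thesis
    using \<open>w \<in> carrier W\<close> \<open>b \<in> chambers X\<close>
  \<comment> \<open>The chamber is generalized because in a product the second factor acts at
    \<open>act v b\<close>.\<close>
  proof (induction arbitrary: b rule: X.W_generated_induct)
    case one
    then show ?case by (simp add: X.act_one Y.act_one closed)
  next
    case (gen i)
    have "(f b, f (flip X i b)) \<in> adj Y i"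
      using f X.flip_adj(1)[OF gen] gen by (auto simp: chamber_morphism_def)
    moreover have "f (flip X i b) \<noteq> f b"
      using inj X.flip_adj(2)[OF gen] X.flip_closed[OF gen] gen by (auto simp: inj_on_def)
    ultimately show ?case
      using Y.flip_eqI gen by (simp add: X.act_gen Y.act_gen)
  next
    case (mult v w)
    then show ?case by (simp add: X.act_mult Y.act_mult X.act_closed closed)
  qed
qed

section \<open>Simple transitivity of \<open>W\<close> and the \<open>W\<close>-valued distance on
  an apartment\<close>

locale homogeneous_thin_system = thin_system_of_type W I s X \<phi>
  for W :: "('w, 'm) monoid_scheme" and I :: "'i set" and s :: "'i \<Rightarrow> 'w"
    and X :: "('c, 'i) chamber_graph" and \<phi> :: "('c \<Rightarrow> 'c) \<Rightarrow> 'w" +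
  assumes connected: "chamber_connected X" and homogeneous: "homogeneous I X"
begin

text \<open>Follow a path of edges from \<open>b\<close> to \<open>c\<close>: crossing an edge
  labelled \<open>i\<close> is a flip, which multiplies the current \<open>w\<close> on the right by
  \<open>s i\<close>.\<close>

lemma act_transitive:
  assumes "b \<in> chambers X" "c \<in> chambers X"
  shows "\<exists>w\<in>carrier W. act w b = c"
proof -
  have "(b, c) \<in> {(x, y). {x, y} \<in> edges X}\<^sup>*"
    using connected assms by (auto simp: chamber_connected_def)
  then show ?thesis
  proof induction
    case base
    then show ?case using act_one assms(1) monoid.one_closed group.is_monoid group_W by metis
  next
    case (step y z)
    then obtain w where w: "w \<in> carrier W" "act w b = y" by blast
    have e: "{y, z} \<in> edges X" using step by simp
    define i where "i = label X {y, z}"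
    have i: "i \<in> I" using sys e by (auto simp: chamber_system_def i_def)
    have "y \<in> chambers X \<and> z \<in> chambers X \<and> y \<noteq> z"
      using sys e by (fastforce simp: chamber_system_def doubleton_eq_iff)
    then have "flip X i y = z"
      using e i by (intro flip_eqI) (auto simp: adj_def i_def)
    then have "act (w \<otimes>\<^bsub>W\<^esub> s i) b = z"
      using w i assms by (simp add: act_mult act_gen s_carrier)
    then show ?case
      using w s_carrier[OF i] monoid.m_closed[OF group.is_monoid[OF group_W]] by blast
  qed
qed

text \<open>An automorphism taking \<open>b\<close> to \<open>c\<close> commutes with the action, so
  agreement of \<open>v\<close> and \<open>w\<close> at the single chamber \<open>b\<close> spreads
  to every chamber.\<close>

lemma act_inj:
  assumes "v \<in> carrier W" "w \<in> carrier W" "b \<in> chambers X" "act v b = act w b"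
  shows "v = w"
proof -
  have "act v c = act w c" if c: "c \<in> chambers X" for c
  proof -
    obtain f where f: "f \<in> carrier (chamber_Aut I X)" "f b = c"
      using homogeneous assms c by (auto simp: homogeneous_def transitive_on_def)
    have f': "chamber_morphism I X X f" "inj_on f (chambers X)"
      using f by (auto simp: chamber_Aut_def Bij_def bij_betw_def)
    have "act u c = f (act u b)" if "u \<in> carrier W" for u
      using act_morphism[OF thin_system_of_type_axioms thin_system_of_type_axioms f' that assms(3)]
      by (simp add: f(2))
    then show ?thesis using assms by simp
  qed
  \<comment> \<open>Agreement on chambers becomes equality of functions because both permutations
    take the same default value elsewhere.\<close>
  moreover have "act v \<in> extensional (chambers X)" "act w \<in> extensional (chambers X)"
    using act_carrier structure_group_Bij assms Bij_imp_extensional by blast+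
  ultimately have "act v = act w" by (meson extensionalityI)
  then show ?thesis using \<phi>_act assms by metis
qed

definition dist :: "'c \<Rightarrow> 'c \<Rightarrow> 'w" where
  "dist b c = \<phi> (thin_dist I X b c)"

text \<open>Freeness makes the description in \<open>thin_dist\<close> unique. With transitivity,
  \<open>dist b c\<close> becomes the one \<open>w\<close> with c = bw, and the properties below
  follow from this.\<close>

lemma dist_act:
  assumes "w \<in> carrier W" "b \<in> chambers X"
  shows "dist b (act w b) = w"
proof -
  have "thin_dist I X b (act w b) = act w"
    unfolding thin_dist_def
  proof (rule the_equality)
    fix u assume u: "u \<in> carrier H \<and> act w b = u b"
    then have "act (\<phi> u) b = act w b" by (simp add: act_\<phi>)
    then have "\<phi> u = w" using act_inj \<phi>_carrier u assms by blast
    then show "u = act w" using act_\<phi>[of u] u by simp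
  qed (simp add: act_carrier assms)
  then show ?thesis by (simp add: dist_def \<phi>_act assms)
qed

lemma dist_closed: "b \<in> chambers X \<Longrightarrow> c \<in> chambers X \<Longrightarrow> dist b c \<in> carrier W"
  using act_transitive dist_act by metis

lemma act_dist: "b \<in> chambers X \<Longrightarrow> c \<in> chambers X \<Longrightarrow> act (dist b c) b = c"
  using act_transitive dist_act by metis

text \<open>Going from \<open>b\<close> to \<open>c\<close> and back is the action of a product that
  fixes \<open>b\<close>, hence of the identity.\<close>

lemma dist_inverse:
  assumes "b \<in> chambers X" "c \<in> chambers X"
  shows "dist b c = inv\<^bsub>W\<^esub> (dist c b)"
proof -
  interpret W: group W by (rule group_W)
  have "act (dist b c \<otimes>\<^bsub>W\<^esub> dist c b) b = act \<one>\<^bsub>W\<^esub> b"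
    using assms by (simp add: act_mult dist_closed act_dist act_one)
  then have "dist b c \<otimes>\<^bsub>W\<^esub> dist c b = \<one>\<^bsub>W\<^esub>"
    using assms act_inj dist_closed by blast
  then show ?thesis using W.inv_equality assms dist_closed by metis
qed

lemma dist_adj:
  assumes "i \<in> I" "b \<in> chambers X" "(c, d) \<in> adj X i"
  shows "(dist b c, dist b d) \<in> group_adj W s i"
proof -
  interpret W: group W by (rule group_W)
  have cd: "c \<in> chambers X" "d \<in> chambers X" using assms by (auto simp: adj_def)
  have "dist b d = dist b c \<otimes>\<^bsub>W\<^esub> s i" if "d \<noteq> c"
  proof -
    have "act (dist b c \<otimes>\<^bsub>W\<^esub> s i) b = d"
      using flip_eqI[OF assms(1,3) that] assms cd
      by (simp add: act_mult dist_closed act_dist s_carrier act_gen)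
    then show ?thesis
      using dist_act[of "dist b c \<otimes>\<^bsub>W\<^esub> s i" b] assms cd by (simp add: dist_closed s_carrier)
  qed
  then show ?thesis using assms cd by (auto simp: group_adj_def dist_closed)
qed

end

text \<open>Since \<open>f\<close> commutes with the action, c = bw is carried to f(c) = f(b)w with
  the same \<open>w\<close>.\<close>

lemma dist_morphism:
  assumes "homogeneous_thin_system W I s X \<phi>" "homogeneous_thin_system W I s Y \<psi>"
    and f: "chamber_morphism I X Y f" and inj: "inj_on f (chambers X)"
    and b: "b \<in> chambers X" and c: "c \<in> chambers X"
  shows "homogeneous_thin_system.dist I Y \<psi> (f b) (f c) = homogeneous_thin_system.dist I X \<phi> b c"
proof -
  interpret X: homogeneous_thin_system W I s X \<phi> by fact
  interpret Y: homogeneous_thin_system W I s Y \<psi> by fact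
  have "f c = Y.act (X.dist b c) (f b)"
    using act_morphism[OF X.thin_system_of_type_axioms Y.thin_system_of_type_axioms f inj
      X.dist_closed[OF b c] b] X.act_dist[OF b c] by simp
  moreover have "f b \<in> chambers Y" using f b by (auto simp: chamber_morphism_def)
  ultimately show ?thesis by (simp add: Y.dist_act X.dist_closed b c)
qed


section \<open>Chamber subsystems\<close>

lemma chambers_subsystem [simp]: "chambers (subsystem \<Delta> A) = A"
  by (simp add: subsystem_def)

lemma adj_subsystem:
  assumes "A \<subseteq> chambers \<Delta>"
  shows "adj (subsystem \<Delta> A) i = adj \<Delta> i \<inter> A \<times> A"
  using assms by (auto simp: adj_def subsystem_def)

lemma chamber_system_subsystem:
  assumes "chamber_system I \<Delta>" "A \<subseteq> chambers \<Delta>"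
  shows "chamber_system I (subsystem \<Delta> A)"
proof -
  have "equiv A (adj (subsystem \<Delta> A) i)" if "i \<in> I" for i
  proof -
    have "equiv (chambers \<Delta>) (adj \<Delta> i)" using assms that by (simp add: chamber_system_def)
    then have "refl_on (chambers \<Delta>) (adj \<Delta> i)" "sym (adj \<Delta> i)" "trans (adj \<Delta> i)"
      by (auto elim: equivE)
    then have "refl_on A (adj \<Delta> i \<inter> A \<times> A)" "sym (adj \<Delta> i \<inter> A \<times> A)" "trans (adj \<Delta> i \<inter> A \<times> A)"
      using assms(2) by (auto simp: refl_on_def intro!: symI transI dest: symD transD)
    then show ?thesis
      unfolding adj_subsystem[OF assms(2)] by (intro equivI) auto
  qed
  moreover have "\<exists>b c. e = {b, c} \<and> b \<in> A \<and> c \<in> A \<and> b \<noteq> c" if "e \<in> edges \<Delta>" "e \<subseteq> A" for e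
    using assms(1) that unfolding chamber_system_def by blast
  ultimately show ?thesis
    using assms(1) by (auto simp: chamber_system_def subsystem_def)
qed

lemma chamber_morphism_subsystem:
  assumes "chamber_morphism I \<Delta> \<Delta>' f" "A \<subseteq> chambers \<Delta>" "B \<subseteq> chambers \<Delta>'" "f ` A \<subseteq> B"
  shows "chamber_morphism I (subsystem \<Delta> A) (subsystem \<Delta>' B) f"
  using assms(1,4) unfolding chamber_morphism_def adj_subsystem[OF assms(2)] adj_subsystem[OF assms(3)]
  by fastforce


section \<open>Gluing the distances of the apartments\<close>

locale strongly_transitive_complex =
  fixes W :: "('w, 'm) monoid_scheme" and I :: "'i set" and s :: "'i \<Rightarrow> 'w"
    and \<Delta> :: "('c, 'i) chamber_graph" and \<A> :: "'c set set" and G :: "('c \<Rightarrow> 'c) set"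
  assumes inv_group: "involution_group W I s"
    and sys: "chamber_system I \<Delta>"
    and nonempty: "chambers \<Delta> \<noteq> {}"
    and complex: "apartment_complex I \<Delta> \<A>"
    and isos: "\<And>A. A \<in> \<A> \<Longrightarrow> structure_isos W I s (subsystem \<Delta> A) \<noteq> {}"
    and subgroup: "subgroup G (chamber_Aut I \<Delta>)"
    and preserves: "preserves_complex G \<A>"
    and strongly: "strongly_transitive G \<A>"
    and R: "condition_R I \<Delta> G \<A>"
begin

text \<open>Any choice gives the same map on the structure group, since the flips generate it and
  their images are prescribed.\<close>

definition type_iso :: "'c set \<Rightarrow> ('c \<Rightarrow> 'c) \<Rightarrow> 'w" where
  "type_iso A = (SOME \<phi>. \<phi> \<in> structure_isos W I s (subsystem \<Delta> A))"

definition apartment_dist :: "'c set \<Rightarrow> 'c \<Rightarrow> 'c \<Rightarrow> 'w" where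
  "apartment_dist A b c = type_iso A (thin_dist I (subsystem \<Delta> A) b c)"

text \<open>The apartment is chosen arbitrarily; \<open>building_dist_eq\<close> removes the
  dependence on it.\<close>

definition building_dist :: "'c \<Rightarrow> 'c \<Rightarrow> 'w" where
  "building_dist b c = apartment_dist (SOME A. A \<in> \<A> \<and> b \<in> A \<and> c \<in> A) b c"

lemma type_iso: "A \<in> \<A> \<Longrightarrow> type_iso A \<in> structure_isos W I s (subsystem \<Delta> A)"
  unfolding type_iso_def using isos[of A] by (simp add: some_in_eq)

lemma apartment: "A \<in> \<A> \<Longrightarrow> apartment I \<Delta> A"
  using complex by (simp add: apartment_complex_def)

lemma apartment_subset: "A \<in> \<A> \<Longrightarrow> A \<subseteq> chambers \<Delta>"
  using apartment by (simp add: apartment_def)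

lemma common_apartment:
  "b \<in> chambers \<Delta> \<Longrightarrow> c \<in> chambers \<Delta> \<Longrightarrow> \<exists>A\<in>\<A>. b \<in> A \<and> c \<in> A"
  using complex by (simp add: apartment_complex_def)

lemma homogeneous_thin_apartment:
  assumes "A \<in> \<A>"
  shows "homogeneous_thin_system W I s (subsystem \<Delta> A) (type_iso A)"
  using apartment[OF assms] type_iso[OF assms] chamber_system_subsystem[OF sys] inv_group
  by unfold_locales (simp_all add: apartment_def)

lemma apartment_dist_eq:
  "A \<in> \<A> \<Longrightarrow> apartment_dist A = homogeneous_thin_system.dist I (subsystem \<Delta> A) (type_iso A)"
  by (intro ext) (simp add: apartment_dist_def
      homogeneous_thin_system.dist_def[OF homogeneous_thin_apartment])

lemma G_morphism: "g \<in> G \<Longrightarrow> chamber_morphism I \<Delta> \<Delta> g"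
  and G_inj: "g \<in> G \<Longrightarrow> inj_on g (chambers \<Delta>)"
  using subgroup.subset[OF subgroup] by (auto simp: chamber_Aut_def Bij_def bij_betw_def)

lemma G_closed: "g \<in> G \<Longrightarrow> b \<in> chambers \<Delta> \<Longrightarrow> g b \<in> chambers \<Delta>"
  using G_morphism by (auto simp: chamber_morphism_def)

lemma G_apartment: "g \<in> G \<Longrightarrow> A \<in> \<A> \<Longrightarrow> g ` A \<in> \<A>"
  using preserves by (simp add: preserves_complex_def)

section \<open>Transport of distances between apartments by elements of \<open>G\<close>\<close>

lemma R_chamber:
  assumes "b \<in> chambers \<Delta>" "c \<in> chambers \<Delta>"
    and "A \<in> \<A>" "b \<in> A" "c \<in> A" "B \<in> \<A>" "b \<in> B" "c \<in> B"
  obtains g where "g \<in> G" "g b = b" "g c = c" "g ` A = B"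
proof -
  have "transitive_on (stabilizer (Aut_subgroup I \<Delta> G) (\<lambda>g. g) b \<inter>
      stabilizer (Aut_subgroup I \<Delta> G) (\<lambda>g. g) c) (\<lambda>g A. g ` A) {A \<in> \<A>. b \<in> A \<and> c \<in> A}"
    using R assms(1,2) by (simp add: condition_R_def)
  then obtain g where "g \<in> stabilizer (Aut_subgroup I \<Delta> G) (\<lambda>g. g) b \<inter>
      stabilizer (Aut_subgroup I \<Delta> G) (\<lambda>g. g) c" "g ` A = B"
    unfolding transitive_on_def using assms(3-) by blast
  then show ?thesis by (intro that[of g]) (auto simp: stabilizer_def Aut_subgroup_def)
qed

lemma R_panel:
  assumes "b \<in> chambers \<Delta>" "i \<in> I" "p \<in> panels \<Delta> i"
    and "A \<in> \<A>" "b \<in> A" "p \<inter> A \<noteq> {}" "B \<in> \<A>" "b \<in> B" "p \<inter> B \<noteq> {}"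
  obtains g where "g \<in> G" "g b = b" "g ` p = p" "g ` A = B"
proof -
  have "transitive_on (stabilizer (Aut_subgroup I \<Delta> G) (\<lambda>g. g) b \<inter>
      stabilizer (Aut_subgroup I \<Delta> G) (\<lambda>g X. g ` X) p) (\<lambda>g A. g ` A) {A \<in> \<A>. b \<in> A \<and> p \<inter> A \<noteq> {}}"
    using R assms(1-3) by (simp add: condition_R_def)
  then obtain g where "g \<in> stabilizer (Aut_subgroup I \<Delta> G) (\<lambda>g. g) b \<inter>
      stabilizer (Aut_subgroup I \<Delta> G) (\<lambda>g X. g ` X) p" "g ` A = B"
    unfolding transitive_on_def using assms(4-) by blast
  then show ?thesis by (intro that[of g]) (auto simp: stabilizer_def Aut_subgroup_def)
qed

lemma strongly_transitiveE:
  assumes "A \<in> \<A>" "a \<in> A" "B \<in> \<A>" "b \<in> B"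
  obtains g where "g \<in> G" "g a = b" "g ` A = B"
proof -
  have "(a, A) \<in> {(a, A). a \<in> A \<and> A \<in> \<A>}" "(b, B) \<in> {(a, A). a \<in> A \<and> A \<in> \<A>}"
    using assms by auto
  then obtain g where "g \<in> G" "(\<lambda>(a, A). (g a, g ` A)) (a, A) = (b, B)"
    using strongly unfolding strongly_transitive_def transitive_on_def by blast
  then show ?thesis by (intro that[of g]) auto
qed

lemma apartment_dist_image:
  assumes "g \<in> G" "A \<in> \<A>" "b \<in> A" "c \<in> A"
  shows "apartment_dist (g ` A) (g b) (g c) = apartment_dist A b c"
proof -
  have gA: "g ` A \<in> \<A>" using G_apartment assms by blast
  have "chamber_morphism I (subsystem \<Delta> A) (subsystem \<Delta> (g ` A)) g"
    using chamber_morphism_subsystem[OF G_morphism] apartment_subset gA assms by blast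
  moreover have "inj_on g A"
    using inj_on_subset[OF G_inj apartment_subset] assms by blast
  ultimately show ?thesis
    using dist_morphism[OF homogeneous_thin_apartment homogeneous_thin_apartment] gA assms
    by (simp add: apartment_dist_eq)
qed

text \<open>The element of \<open>G\<close> given by (R) carries \<open>A\<close> to
  \<open>B\<close> while fixing \<open>b\<close> and \<open>c\<close>.\<close>

lemma apartment_dist_unique:
  assumes "A \<in> \<A>" "b \<in> A" "c \<in> A" "B \<in> \<A>" "b \<in> B" "c \<in> B"
  shows "apartment_dist A b c = apartment_dist B b c"
proof -
  have "b \<in> chambers \<Delta>" "c \<in> chambers \<Delta>" using apartment_subset assms by blast+
  then obtain g where "g \<in> G" "g b = b" "g c = c" "g ` A = B"
    using R_chamber assms by metis
  then show ?thesis using apartment_dist_image[of g A b c] assms by simp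
qed

lemma building_dist_eq:
  assumes "A \<in> \<A>" "b \<in> A" "c \<in> A"
  shows "building_dist b c = apartment_dist A b c"
proof -
  have "\<exists>A. A \<in> \<A> \<and> b \<in> A \<and> c \<in> A" using assms by blast
  from someI_ex[OF this] show ?thesis
    unfolding building_dist_def using apartment_dist_unique assms by blast
qed

lemma building_dist_closed_inverse:
  assumes "b \<in> chambers \<Delta>" "c \<in> chambers \<Delta>"
  shows "building_dist b c \<in> carrier W" "building_dist b c = inv\<^bsub>W\<^esub> (building_dist c b)"
proof -
  obtain A where A: "A \<in> \<A>" "b \<in> A" "c \<in> A" using common_apartment assms by blast
  interpret A: homogeneous_thin_system W I s "subsystem \<Delta> A" "type_iso A"
    using homogeneous_thin_apartment A by blast
  show "building_dist b c \<in> carrier W" "building_dist b c = inv\<^bsub>W\<^esub> (building_dist c b)"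
    using A.dist_closed[of b c] A.dist_inverse[of b c] A
    by (simp_all add: building_dist_eq apartment_dist_eq)
qed

lemma building_dist_adj:
  assumes "i \<in> I" "b \<in> chambers \<Delta>" "(c', c) \<in> adj \<Delta> i"
  shows "(building_dist b c', building_dist b c) \<in> group_adj W s i"
proof -
  have eq: "equiv (chambers \<Delta>) (adj \<Delta> i)" using sys assms by (simp add: chamber_system_def)
  have cc: "c \<in> chambers \<Delta>" "c' \<in> chambers \<Delta>" using assms by (auto simp: adj_def)
  obtain A where A: "A \<in> \<A>" "b \<in> A" "c' \<in> A" using common_apartment assms cc by blast
  obtain B where B: "B \<in> \<A>" "b \<in> B" "c \<in> B" using common_apartment assms cc by blast
  \<comment> \<open>\<open>A\<close> and \<open>B\<close> were chosen separately, but both meet the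
    panel of \<open>c\<close>: the first in \<open>c'\<close>, the second in \<open>c\<close>. So
    (R) for \<open>b\<close> and this panel relates them.\<close>
  define p where "p = adj \<Delta> i `` {c}"
  have p: "p \<in> panels \<Delta> i" by (simp add: p_def panels_def quotientI cc)
  have cp: "c \<in> p" "c' \<in> p"
    using equiv_class_self[OF eq] cc assms eq by (auto simp: p_def equiv_def dest: symD)
  then have "p \<inter> A \<noteq> {}" "p \<inter> B \<noteq> {}" using A B by auto
  then obtain g where g: "g \<in> G" "g b = b" "g ` p = p" "g ` A = B"
    using R_panel[OF assms(2,1) p A(1,2) _ B(1,2)] by blast
  have gB: "g c' \<in> B" and gp: "g c' \<in> p" using g A cp by blast+
  have "(g c', c) \<in> adj \<Delta> i" using gp eq by (auto simp: p_def equiv_def dest: symD)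
  then have adj: "(g c', c) \<in> adj (subsystem \<Delta> B) i"
    using adj_subsystem[OF apartment_subset] B gB by blast
  interpret B: homogeneous_thin_system W I s "subsystem \<Delta> B" "type_iso B"
    using homogeneous_thin_apartment B by blast
  \<comment> \<open>As \<open>g\<close> fixes \<open>b\<close>, replacing \<open>c'\<close> by
    \<open>g c'\<close> leaves the distance unchanged and reduces the claim to two
    \<open>i\<close>-adjacent chambers of the single apartment \<open>B\<close>.\<close>
  have "building_dist b c' = apartment_dist B b (g c')"
    using building_dist_eq[OF A] apartment_dist_image[OF g(1) A] g by simp
  then show ?thesis
    using B.dist_adj[OF assms(1) _ adj, of b] B by (simp add: building_dist_eq apartment_dist_eq)
qed

lemma W_distance_building_dist: "W_distance W I s \<Delta> building_dist"
  unfolding W_distance_def using building_dist_closed_inverse building_dist_adj by blast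

text \<open>The witness is \<open>type_iso A\<close>, through which the distance on \<open>A\<close>
  was defined.\<close>

lemma compatible_building_dist: "A \<in> \<A> \<Longrightarrow> compatible W I s \<Delta> building_dist A"
  unfolding compatible_def using type_iso building_dist_eq apartment_dist_def by metis

section \<open>Orbits of \<open>G\<close> on pairs of chambers as fibres of the distance\<close>

lemma building_dist_G:
  assumes "g \<in> G" "b \<in> chambers \<Delta>" "c \<in> chambers \<Delta>"
  shows "building_dist (g b) (g c) = building_dist b c"
proof -
  obtain A where A: "A \<in> \<A>" "b \<in> A" "c \<in> A" using common_apartment assms by blast
  then show ?thesis
    using building_dist_eq[OF A] building_dist_eq[of "g ` A" "g b" "g c"]
      apartment_dist_image[OF assms(1) A] G_apartment assms by simp
qed

text \<open>Strong transitivity aligns the first chambers and the apartments; the second chambers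
  then have equal distance from \<open>b'\<close> inside \<open>B\<close>.\<close>

lemma building_dist_eq_imp_orbit:
  assumes "b \<in> chambers \<Delta>" "c \<in> chambers \<Delta>" "b' \<in> chambers \<Delta>" "c' \<in> chambers \<Delta>"
    and "building_dist b c = building_dist b' c'"
  shows "\<exists>g\<in>G. g b = b' \<and> g c = c'"
proof -
  obtain A where A: "A \<in> \<A>" "b \<in> A" "c \<in> A" using common_apartment assms by blast
  obtain B where B: "B \<in> \<A>" "b' \<in> B" "c' \<in> B" using common_apartment assms by blast
  obtain g where g: "g \<in> G" "g b = b'" "g ` A = B"
    using strongly_transitiveE[OF A(1,2) B(1,2)] .
  interpret B: homogeneous_thin_system W I s "subsystem \<Delta> B" "type_iso B"
    using homogeneous_thin_apartment B by blast
  have gc: "g c \<in> B" using g A by blast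
  have "apartment_dist B b' (g c) = apartment_dist B b' c'"
    using apartment_dist_image[OF g(1) A] g assms(5) building_dist_eq[OF A] building_dist_eq[OF B]
    by simp
  \<comment> \<open>A chamber of \<open>B\<close> is recovered from its distance to
    \<open>b'\<close> by letting that distance act on \<open>b'\<close>.\<close>
  moreover have "B.act (apartment_dist B b' x) b' = x" if "x \<in> B" for x
    using B.act_dist that B by (simp add: apartment_dist_eq)
  ultimately have "g c = c'" using gc B by metis
  then show ?thesis using g by blast
qed

text \<open>One inclusion is invariance of the distance under \<open>G\<close>, the other is
  \<open>building_dist_eq_imp_orbit\<close>. This yields both well-definedness and injectivity of
  the map on orbits.\<close>

lemma orbit_eq_fibre:
  assumes "b \<in> chambers \<Delta>" "c \<in> chambers \<Delta>"
  shows "orbit (Aut_subgroup I \<Delta> G) pair_action (b, c) =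
    {(x, y) \<in> chambers \<Delta> \<times> chambers \<Delta>. building_dist x y = building_dist b c}"
proof -
  have "(x, y) \<in> orbit (Aut_subgroup I \<Delta> G) pair_action (b, c) \<longleftrightarrow> (\<exists>g\<in>G. g b = x \<and> g c = y)" for x y
    by (auto simp: orbit_def pair_action_def Aut_subgroup_def)
  then show ?thesis
    using building_dist_eq_imp_orbit[OF assms] building_dist_G G_closed assms by fastforce
qed

text \<open>A single apartment already realizes every \<open>w\<close>: take a chamber
  \<open>b\<close> in it together with bw.\<close>

lemma building_dist_surj:
  assumes "w \<in> carrier W"
  shows "\<exists>b\<in>chambers \<Delta>. \<exists>c\<in>chambers \<Delta>. building_dist b c = w"
proof -
  obtain b where b: "b \<in> chambers \<Delta>" using nonempty by blast
  then obtain A where A: "A \<in> \<A>" "b \<in> A" using common_apartment by blast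
  interpret A: homogeneous_thin_system W I s "subsystem \<Delta> A" "type_iso A"
    using homogeneous_thin_apartment A by blast
  have c: "A.act w b \<in> A" using A.act_closed[OF assms] A by simp
  then have "building_dist b (A.act w b) = w"
    using A.dist_act[OF assms] A by (simp add: building_dist_eq apartment_dist_eq)
  then show ?thesis using b c apartment_subset A by blast
qed

lemma induces_orbit_bijection_building_dist: "induces_orbit_bijection W I \<Delta> G building_dist"
proof -
  let ?orb = "orbit (Aut_subgroup I \<Delta> G) pair_action"
  \<comment> \<open>The map evaluates the distance at an arbitrary representative, which is harmless
    because the distance is constant on each orbit.\<close>
  define f where "f S = (\<lambda>(b, c). building_dist b c) (SOME x. x \<in> S)" for S
  have f: "f (?orb (b, c)) = building_dist b c" if "b \<in> chambers \<Delta>" "c \<in> chambers \<Delta>" for b c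
  proof -
    have "(b, c) \<in> ?orb (b, c)" using that by (simp add: orbit_eq_fibre)
    then have "(SOME x. x \<in> ?orb (b, c)) \<in> ?orb (b, c)" by (rule someI)
    then show ?thesis unfolding f_def orbit_eq_fibre[OF that] by auto
  qed
  have "bij_betw f (orbits (Aut_subgroup I \<Delta> G) (chambers \<Delta> \<times> chambers \<Delta>) pair_action) (carrier W)"
    unfolding bij_betw_def
  proof
    show "inj_on f (orbits (Aut_subgroup I \<Delta> G) (chambers \<Delta> \<times> chambers \<Delta>) pair_action)"
      by (auto simp: inj_on_def orbits_def f) (auto simp: orbit_eq_fibre)
    show "f ` orbits (Aut_subgroup I \<Delta> G) (chambers \<Delta> \<times> chambers \<Delta>) pair_action = carrier W"
      using building_dist_closed_inverse(1) building_dist_surj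
      by (auto simp: orbits_def f image_iff) (metis f)
  qed
  then show ?thesis unfolding induces_orbit_bijection_def using f by blast
qed

lemma building_building_dist: "building W I s \<Delta> building_dist"
  unfolding building_def
  using sys W_distance_building_dist compatible_building_dist common_apartment apartment by meson

end

theorem theorem4p21:
  fixes W :: "('w, 'm) monoid_scheme"
    and I :: "'i set"
    and s :: "'i \<Rightarrow> 'w"
    and \<Delta> :: "('c, 'i) chamber_graph"
    and \<A> :: "'c set set"
    and G :: "('c \<Rightarrow> 'c) set"
  assumes "involution_group W I s"
    and "chamber_system I \<Delta>"
    and "chambers \<Delta> \<noteq> {}"
    and "firm I \<Delta>"
    and "chamber_connected \<Delta>"
    and "apartment_complex I \<Delta> \<A>"
    and "\<And>A. A \<in> \<A> \<Longrightarrow> structure_isos W I s (subsystem \<Delta> A) \<noteq> {}"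
    and "subgroup G (chamber_Aut I \<Delta>)"
    and "preserves_complex G \<A>"
    and "strongly_transitive G \<A>"
    and "condition_R I \<Delta> G \<A>"
  shows "\<exists>\<delta>. building W I s \<Delta> \<delta> \<and>
             (\<forall>A\<in>\<A>. compatible W I s \<Delta> \<delta> A) \<and>
             (\<forall>b\<in>chambers \<Delta>. \<forall>c\<in>chambers \<Delta>. \<exists>A\<in>\<A>. b \<in> A \<and> c \<in> A) \<and>
             induces_orbit_bijection W I \<Delta> G \<delta>"
proof -
  interpret strongly_transitive_complex W I s \<Delta> \<A> G
    by (rule strongly_transitive_complex.intro[OF assms(1-3,6-)])
  show ?thesis
    using building_building_dist compatible_building_dist common_apartment
      induces_orbit_bijection_building_dist by blast
qed

end
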